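(* Let $d=p_0^{\alpha_0}p_1^{\alpha_1}\cdots p_r^{\alpha_r}$ be the prime factorization of the integer $d\ge 3$, where $r\ge 0$, $p_0=2$, $p_1=3$, $p_i>3$ for $i\ge 2$, $\alpha_0,\alpha_1\ge 0$, and $\alpha_i>0$ for $2\le i\le r$. The number of classes of non-equivalent actions of representations $M_a$ of $\mathbb{Z}/d\mathbb{Z}$ on $K[x,y,z]_d$ is $N_2+N_3+N_4+N_6$.
   Context: $K$ is an algebraically closed field of characteristic zero, $e\in K$ is a primitive $d$-th root of $1$, and, for $2\le a\le d-1$, $M_a=\mathrm{diag}(1,e,e^a)$ acts on $K[x,y,z]$ by $x\mapsto x$, $y\mapsto ey$, $z\mapsto e^a z$. $K[x,y,z]_d$ is the space of forms of degree $d$. The actions of $M_a$ and $M_b$ on $K[x,y,z]_d$ are equivalent if the homogeneous artinian ideals generated by the forms of degree $d$ invariant under $M_a$, respectively $M_b$, coincide up to a permutation of the variables. Classes are the equivalence classes of this relation, regarded as subsets of $\{2,\dots,d-1\}$ (the values of $a$), and $N_i$ denotes the number of classes with exactly $i$ elements. The primes $p_i$ are distinct.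
   Formalization: The case d = 3 is excluded: there the only class is {2}, with exactly one element, so the number of classes is 1 while N_2 + N_3 + N_4 + N_6 = 0. *)

theory Defs
  imports "HOL-Library.Poly_Mapping" "HOL-Computational_Algebra.Polynomial"
begin

datatype var = X | Y | Z

text \<open>\<open>K[x,y,z]\<close> is the monoid algebra over \<open>K\<close> of the monoid of exponent vectors; its ring
  structure is the convolution product of \<^theory>\<open>HOL-Library.Poly_Mapping\<close>.\<close>

type_synonym 'k poly3 = "(var \<Rightarrow>\<^sub>0 nat) \<Rightarrow>\<^sub>0 'k"

definition Const3 :: "'k::comm_ring_1 \<Rightarrow> 'k poly3" where
  "Const3 c = Poly_Mapping.single 0 c"

definition Var3 :: "var \<Rightarrow> 'k::comm_ring_1 poly3" where
  "Var3 v = Poly_Mapping.single (Poly_Mapping.single v 1) 1"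

text \<open>The \<open>K\<close>-algebra endomorphism of \<open>K[x,y,z]\<close> that sends each variable \<open>v\<close> to \<open>f v\<close>.\<close>

definition subst3 :: "(var \<Rightarrow> 'k poly3) \<Rightarrow> 'k::comm_ring_1 poly3 \<Rightarrow> 'k poly3" where
  "subst3 f p = (\<Sum>m \<in> Poly_Mapping.keys p.
     Const3 (Poly_Mapping.lookup p m) * (\<Prod>v \<in> {X, Y, Z}. f v ^ Poly_Mapping.lookup m v))"

definition forms :: "nat \<Rightarrow> 'k::comm_ring_1 poly3 set" where
  "forms d = {F. \<forall>m \<in> Poly_Mapping.keys F. (\<Sum>v \<in> {X, Y, Z}. Poly_Mapping.lookup m v) = d}"

text \<open>The ring is regarded as a module over itself, so the span is the generated ideal.\<close>

definition ideal_gen :: "'a::comm_ring_1 set \<Rightarrow> 'a set" where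
  "ideal_gen G = module.span (*) G"

definition primitive_root_of_1 :: "nat \<Rightarrow> 'a::monoid_mult \<Rightarrow> bool" where
  "primitive_root_of_1 d e \<longleftrightarrow> e ^ d = 1 \<and> (\<forall>k. 0 < k \<and> k < d \<longrightarrow> e ^ k \<noteq> 1)"

text \<open>The diagonal entries of \<open>M\<^sub>a = diag(1, e, e^a)\<close>.\<close>

fun M_diag :: "'k::comm_ring_1 \<Rightarrow> nat \<Rightarrow> var \<Rightarrow> 'k" where
  "M_diag e a X = 1"
| "M_diag e a Y = e"
| "M_diag e a Z = e ^ a"

definition M_act :: "'k::comm_ring_1 \<Rightarrow> nat \<Rightarrow> 'k poly3 \<Rightarrow> 'k poly3" where
  "M_act e a = subst3 (\<lambda>v. Const3 (M_diag e a v) * Var3 v)"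

text \<open>For \<open>e\<close> a primitive \<open>d\<close>-th root of 1 this ideal is automatically homogeneous and artinian:
  its generators are forms, and they include \<open>x^d\<close>, \<open>y^d\<close> and \<open>z^d\<close>.\<close>

definition invariant_ideal :: "'k::comm_ring_1 \<Rightarrow> nat \<Rightarrow> nat \<Rightarrow> 'k poly3 set" where
  "invariant_ideal e d a = ideal_gen {F \<in> forms d. M_act e a F = F}"

definition permute_vars :: "(var \<Rightarrow> var) \<Rightarrow> 'k::comm_ring_1 poly3 \<Rightarrow> 'k poly3" where
  "permute_vars \<pi> = subst3 (\<lambda>v. Var3 (\<pi> v))"

definition equivalent_actions :: "'k::comm_ring_1 \<Rightarrow> nat \<Rightarrow> (nat \<times> nat) set" where
  "equivalent_actions e d = {(a, b). a \<in> {2..d - 1} \<and> b \<in> {2..d - 1} \<and>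
     (\<exists>\<pi>. bij \<pi> \<and> permute_vars \<pi> ` invariant_ideal e d a = invariant_ideal e d b)}"

definition action_classes :: "'k::comm_ring_1 \<Rightarrow> nat \<Rightarrow> nat set set" where
  "action_classes e d = {2..d - 1} // equivalent_actions e d"

definition N_classes :: "'k::comm_ring_1 \<Rightarrow> nat \<Rightarrow> nat \<Rightarrow> nat" where
  "N_classes e d i = card {C \<in> action_classes e d. card C = i}"

end

(* The ideals are monomial, so equivalence of M_a and M_b means that a permutation of the variables
   matches the invariant exponents (i, j, k), i + j + k = d and d | j + a k. Modulo d this leaves at
   most the six values a, 1 - a, 1/a, 1 - 1/a, 1/(1 - a), a/(a - 1) for b, so classes have at most six
   elements. Exchanging x and y gives the involution a |-> d + 1 - a on each class. If a class has odd
   size, the involution has a fixed point c = 1/2, and the six values collapse to 1/2, 2, -1; since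
   d > 3, 2 is different from c. Hence all class sizes lie in {2, 3, 4, 6}. *)
theory Submission
  imports Defs "HOL-Number_Theory.Cong"
begin

section \<open>Coefficients under scaling and permutation of the variables\<close>

lemma UNIV_var: "(UNIV :: var set) = {X, Y, Z}"
  using var.exhaust by auto

lemma single_var_power:
  "Poly_Mapping.single (Poly_Mapping.single v (Suc 0)) c ^ n
     = Poly_Mapping.single (Poly_Mapping.single v n) (c ^ n)"
  for c :: "'k::comm_ring_1"
proof (induction n)
  case (Suc n)
  have "Poly_Mapping.single v (Suc n) = Poly_Mapping.single v (Suc 0) + Poly_Mapping.single v n"
    by (simp flip: single_add)
  with Suc show ?case by (simp add: mult_single)
qed simp

text \<open>Common form of both substitutions in play: \<open>M_act\<close> is the case where \<pi>
  is the identity, \<open>permute_vars\<close> the case where all scalars are 1. Each monomial goes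
  to a scalar multiple of a single monomial.\<close>

lemma subst3_scaled_vars:
  fixes c :: "var \<Rightarrow> 'k::comm_ring_1"
  shows "subst3 (\<lambda>v. Const3 (c v) * Var3 (\<pi> v)) p =
    (\<Sum>m \<in> Poly_Mapping.keys p.
      Poly_Mapping.single (\<Sum>v\<in>UNIV. Poly_Mapping.single (\<pi> v) (Poly_Mapping.lookup m v))
        (Poly_Mapping.lookup p m * (\<Prod>v\<in>UNIV. c v ^ Poly_Mapping.lookup m v)))"
  unfolding subst3_def Const3_def Var3_def UNIV_var
  by (intro sum.cong) (simp_all add: mult_single single_var_power mult.assoc add.assoc)

lemma lookup_map_key:
  "inj f \<Longrightarrow> Poly_Mapping.lookup (Poly_Mapping.map_key f p) = Poly_Mapping.lookup p \<circ> f"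
  by (fact map_key.rep_eq)

lemma sum_single_permuted:
  fixes m :: "var \<Rightarrow>\<^sub>0 nat"
  assumes "bij \<pi>"
  shows "(\<Sum>v\<in>UNIV. Poly_Mapping.single (\<pi> v) (Poly_Mapping.lookup m v)) = Poly_Mapping.map_key (inv \<pi>) m"
    (is "?l = ?r")
proof (rule poly_mapping_eqI)
  fix w
  have "finite (UNIV::var set)" by (simp add: UNIV_var)
  moreover have "(\<pi> v = w) = (v = inv \<pi> w)" for v
    using assms by (metis bij_inv_eq_iff)
  moreover have "inj (inv \<pi>)" using assms bij_imp_bij_inv bij_is_inj by blast
  ultimately show "Poly_Mapping.lookup ?l w = Poly_Mapping.lookup ?r w"
    by (simp add: lookup_sum lookup_single lookup_map_key when_def sum.delta)
qed

lemma map_key_map_key: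
  assumes "inj f" "inj g"
  shows "Poly_Mapping.map_key f (Poly_Mapping.map_key g p) = Poly_Mapping.map_key (g \<circ> f) p"
  using assms by (intro poly_mapping_eqI) (simp add: lookup_map_key inj_compose)

lemma map_key_bij_inverse:
  assumes "bij \<pi>"
  shows "Poly_Mapping.map_key \<pi> (Poly_Mapping.map_key (inv \<pi>) m) = m"
    "Poly_Mapping.map_key (inv \<pi>) (Poly_Mapping.map_key \<pi> m) = m"
  using assms bij_imp_bij_inv[OF assms]
  by (auto intro!: poly_mapping_eqI simp: lookup_map_key bij_is_inj bij_inv_eq_iff surj_f_inv_f bij_is_surj)

text \<open>Substitution pushes exponents forward along \<pi>, that is, by
  \<open>map_key (inv \<pi>)\<close>. Exactly one exponent lands on m, namely its pullback
  \<open>map_key \<pi> m\<close>, so nothing is added up or cancelled.\<close>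

lemma lookup_permute_vars:
  assumes "bij \<pi>"
  shows "Poly_Mapping.lookup (permute_vars \<pi> F) m = Poly_Mapping.lookup F (Poly_Mapping.map_key \<pi> m)"
proof -
  have "permute_vars \<pi> F = subst3 (\<lambda>v. Const3 1 * Var3 (\<pi> v)) F"
    by (simp add: permute_vars_def Const3_def)
  moreover have "(Poly_Mapping.map_key (inv \<pi>) k = m) = (k = Poly_Mapping.map_key \<pi> m)" for k
    using map_key_bij_inverse[OF assms] by metis
  ultimately show ?thesis
    by (simp add: subst3_scaled_vars sum_single_permuted[OF assms] lookup_sum lookup_single
        when_def in_keys_iff)
qed

lemma permute_vars_inv:
  assumes "bij \<pi>"
  shows "permute_vars \<pi> (permute_vars (inv \<pi>) F) = F"
  using assms bij_imp_bij_inv[OF assms]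
  by (intro poly_mapping_eqI) (simp add: lookup_permute_vars map_key_bij_inverse)

lemma lookup_M_act:
  "Poly_Mapping.lookup (M_act e a F) m =
    Poly_Mapping.lookup F m * e ^ (Poly_Mapping.lookup m Y + a * Poly_Mapping.lookup m Z)"
proof -
  have "(\<Sum>v\<in>UNIV. Poly_Mapping.single v (Poly_Mapping.lookup k v)) = k" for k :: "var \<Rightarrow>\<^sub>0 nat"
    using sum_single_permuted[of id k]
    by (auto intro!: poly_mapping_eqI simp: lookup_map_key inv_id)
  then show ?thesis
    unfolding M_act_def
    by (simp add: subst3_scaled_vars lookup_sum lookup_single when_def in_keys_iff
        UNIV_var power_add power_mult)
qed

lemma primitive_root_power_eq_1_iff:
  assumes "primitive_root_of_1 d e" "d > 0"
  shows "e ^ n = 1 \<longleftrightarrow> d dvd n"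
proof -
  have "e ^ n = (e ^ d) ^ (n div d) * e ^ (n mod d)"
    by (simp flip: power_mult power_add)
  then have "e ^ n = e ^ (n mod d)"
    using assms(1) by (simp add: primitive_root_of_1_def)
  moreover have "e ^ (n mod d) = 1 \<longleftrightarrow> n mod d = 0"
    using assms unfolding primitive_root_of_1_def
    by (metis gr0I mod_less_divisor power_0)
  ultimately show ?thesis by (simp add: dvd_eq_mod_eq_0)
qed

section \<open>Invariant monomials and the monomial ideals they generate\<close>

definition invariant_exponents :: "nat \<Rightarrow> nat \<Rightarrow> (var \<Rightarrow>\<^sub>0 nat) set" where
  "invariant_exponents d a = {m. (\<Sum>v\<in>UNIV. Poly_Mapping.lookup m v) = d
     \<and> d dvd Poly_Mapping.lookup m Y + a * Poly_Mapping.lookup m Z}"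

text \<open>Monomials are eigenvectors of M_a, so a form is fixed iff each of its monomials has
  eigenvalue 1. Cancelling the nonzero coefficients uses that K is a domain.\<close>

lemma invariant_form_iff:
  fixes e :: "'k::idom"
  assumes "primitive_root_of_1 d e" "d > 0"
  shows "F \<in> forms d \<and> M_act e a F = F \<longleftrightarrow> Poly_Mapping.keys F \<subseteq> invariant_exponents d a"
proof -
  have "M_act e a F = F \<longleftrightarrow> (\<forall>m\<in>Poly_Mapping.keys F.
      d dvd Poly_Mapping.lookup m Y + a * Poly_Mapping.lookup m Z)"
    by (auto simp: poly_mapping_eq_iff fun_eq_iff lookup_M_act in_keys_iff
        simp flip: primitive_root_power_eq_1_iff[OF assms])
  then show ?thesis
    by (auto simp: forms_def invariant_exponents_def UNIV_var)
qed

lemma module_mult: "module ((*) :: 'a::comm_ring_1 \<Rightarrow> 'a \<Rightarrow> 'a)"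
  by unfold_locales (simp_all add: algebra_simps)

lemma poly_mapping_sum_single:
  "F = (\<Sum>m\<in>Poly_Mapping.keys F. Poly_Mapping.single m (Poly_Mapping.lookup F m))"
  by (rule poly_mapping_eqI) (simp add: lookup_sum lookup_single when_def in_keys_iff)

text \<open>Membership in a monomial ideal is tested monomial by monomial. The right-hand side is
  itself an ideal containing the generators; conversely, each term of one of its elements is a
  multiple of some monomial with exponent in E.\<close>

lemma ideal_gen_monomials:
  fixes E :: "(var \<Rightarrow>\<^sub>0 nat) set"
  shows "ideal_gen {F :: 'k::comm_ring_1 poly3. Poly_Mapping.keys F \<subseteq> E} =
    {F. \<forall>m\<in>Poly_Mapping.keys F. \<exists>k\<in>E. \<exists>l. m = l + k}" (is "ideal_gen ?G = ?I")
proof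
  interpret module "(*) :: 'k poly3 \<Rightarrow> _" by (rule module_mult)
  have "subspace ?I"
  proof (rule subspaceI)
    fix F H :: "'k poly3" assume "F \<in> ?I" "H \<in> ?I"
    then show "F + H \<in> ?I" using Poly_Mapping.keys_add[of F H] by blast
  next
    fix c F :: "'k poly3" assume F: "F \<in> ?I"
    show "c * F \<in> ?I"
    proof safe
      fix m assume "m \<in> Poly_Mapping.keys (c * F)"
      then obtain n k where "m = n + k" "k \<in> Poly_Mapping.keys F"
        using keys_mult[of c F] by blast
      moreover from this F obtain k' l where "k' \<in> E" "k = l + k'" by blast
      ultimately have "m = (n + l) + k'" by (simp add: add.assoc)
      with \<open>k' \<in> E\<close> show "\<exists>k\<in>E. \<exists>l. m = l + k" by blast
    qed
  qed simp
  moreover have "?G \<subseteq> ?I"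
    by (auto intro!: bexI exI[of _ 0])
  ultimately show "ideal_gen ?G \<subseteq> ?I"
    unfolding ideal_gen_def by (rule span_minimal[rotated])
  show "?I \<subseteq> ideal_gen ?G"
  proof
    fix F assume F: "F \<in> ?I"
    have "Poly_Mapping.single m (Poly_Mapping.lookup F m) \<in> span ?G" if "m \<in> Poly_Mapping.keys F" for m
    proof -
      obtain k l where "k \<in> E" "m = l + k" using F \<open>m \<in> Poly_Mapping.keys F\<close> by blast
      moreover have "Poly_Mapping.single k (1::'k) \<in> span ?G"
        using \<open>k \<in> E\<close> by (intro span_base) simp
      then have "Poly_Mapping.single l (Poly_Mapping.lookup F m) * Poly_Mapping.single k 1 \<in> span ?G"
        by (rule span_scale)
      ultimately show ?thesis by (simp add: mult_single)
    qed
    then have "(\<Sum>m\<in>Poly_Mapping.keys F. Poly_Mapping.single m (Poly_Mapping.lookup F m)) \<in> span ?G"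
      by (rule span_sum)
    then show "F \<in> ideal_gen ?G"
      unfolding ideal_gen_def by (subst poly_mapping_sum_single)
  qed
qed

lemma invariant_ideal_eq:
  fixes e :: "'k::idom"
  assumes "primitive_root_of_1 d e" "d > 0"
  shows "invariant_ideal e d a =
    {F. \<forall>m\<in>Poly_Mapping.keys F. \<exists>k\<in>invariant_exponents d a. \<exists>l. m = l + k}"
  unfolding invariant_ideal_def invariant_form_iff[OF assms] ideal_gen_monomials ..

text \<open>A monomial ideal is determined by the exponents it contains, and here all generators
  have the same degree d. The degree d part therefore recovers the generating exponents, so
  comparing ideals amounts to comparing these.\<close>

lemma permute_vars_image_ideal_iff:
  fixes e :: "'k::idom"
  assumes "primitive_root_of_1 d e" "d > 0" "bij \<pi>"
  shows "permute_vars \<pi> ` invariant_ideal e d a = invariant_ideal e d b \<longleftrightarrow>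
    (\<forall>m. Poly_Mapping.map_key \<pi> m \<in> invariant_exponents d a \<longleftrightarrow> m \<in> invariant_exponents d b)"
    (is "?L \<longleftrightarrow> ?R")
proof -
  \<comment> \<open>The exponents of all monomials in the ideal: the upward closure of the
    generating ones.\<close>
  define U where "U a = {m. \<exists>k\<in>invariant_exponents d a. \<exists>l. m = l + k}" for a
  have I: "F \<in> invariant_ideal e d a \<longleftrightarrow> Poly_Mapping.keys F \<subseteq> U a" for F a
    by (auto simp: invariant_ideal_eq[OF assms(1,2)] U_def)
  have keys: "Poly_Mapping.keys (permute_vars (inv \<pi>) F) = Poly_Mapping.map_key \<pi> ` Poly_Mapping.keys F"
    for F :: "'k poly3"
  proof (rule set_eqI)
    fix m
    have "m \<in> Poly_Mapping.keys (permute_vars (inv \<pi>) F) \<longleftrightarrow>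
        Poly_Mapping.map_key (inv \<pi>) m \<in> Poly_Mapping.keys F"
      by (simp add: in_keys_iff lookup_permute_vars[OF bij_imp_bij_inv[OF assms(3)]])
    also have "\<dots> \<longleftrightarrow> m \<in> Poly_Mapping.map_key \<pi> ` Poly_Mapping.keys F"
      using map_key_bij_inverse[OF assms(3)] by (metis (no_types, lifting) image_iff)
    finally show "m \<in> Poly_Mapping.keys (permute_vars (inv \<pi>) F) \<longleftrightarrow>
        m \<in> Poly_Mapping.map_key \<pi> ` Poly_Mapping.keys F" .
  qed
  have image: "F \<in> permute_vars \<pi> ` invariant_ideal e d a \<longleftrightarrow>
      Poly_Mapping.map_key \<pi> ` Poly_Mapping.keys F \<subseteq> U a" for F
  proof -
    have "F \<in> permute_vars \<pi> ` invariant_ideal e d a \<longleftrightarrow> permute_vars (inv \<pi>) F \<in> invariant_ideal e d a"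
      using permute_vars_inv[OF assms(3)] permute_vars_inv[OF bij_imp_bij_inv[OF assms(3)]]
      by (metis (no_types, lifting) assms(3) image_iff inv_inv_eq)
    also have "\<dots> \<longleftrightarrow> Poly_Mapping.map_key \<pi> ` Poly_Mapping.keys F \<subseteq> U a"
      unfolding I keys by (rule refl)
    finally show ?thesis .
  qed
  have "?L \<longleftrightarrow> (\<forall>F::'k poly3. Poly_Mapping.map_key \<pi> ` Poly_Mapping.keys F \<subseteq> U a \<longleftrightarrow>
      Poly_Mapping.keys F \<subseteq> U b)"
    unfolding set_eq_iff image I ..
  also have "\<dots> \<longleftrightarrow> (\<forall>m. Poly_Mapping.map_key \<pi> m \<in> U a \<longleftrightarrow> m \<in> U b)"
  proof
    assume *: "\<forall>F::'k poly3. Poly_Mapping.map_key \<pi> ` Poly_Mapping.keys F \<subseteq> U a \<longleftrightarrow>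
      Poly_Mapping.keys F \<subseteq> U b"
    show "\<forall>m. Poly_Mapping.map_key \<pi> m \<in> U a \<longleftrightarrow> m \<in> U b"
      \<comment> \<open>A single monomial with coefficient 1 serves as test polynomial.\<close>
      using *[rule_format, of "Poly_Mapping.single _ 1"] by simp
  qed blast
  also have "\<dots> \<longleftrightarrow> ?R"
  proof
    \<comment> \<open>Cutting \<open>U a\<close> down to degree d gives back the generators: if l +
      k and k both have degree d, then l = 0.\<close>
    have exps: "m \<in> invariant_exponents d a \<longleftrightarrow> m \<in> U a \<and> (\<Sum>v\<in>UNIV. Poly_Mapping.lookup m v) = d"
      for m a
    proof
      assume "m \<in> invariant_exponents d a"
      then show "m \<in> U a \<and> (\<Sum>v\<in>UNIV. Poly_Mapping.lookup m v) = d"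
        unfolding U_def invariant_exponents_def by (metis (mono_tags, lifting) add_0 mem_Collect_eq)
    next
      assume *: "m \<in> U a \<and> (\<Sum>v\<in>UNIV. Poly_Mapping.lookup m v) = d"
      then obtain k l where k: "k \<in> invariant_exponents d a" "m = l + k" by (auto simp: U_def)
      then have "Poly_Mapping.lookup l v = 0" for v
        using * by (cases v) (auto simp: invariant_exponents_def UNIV_var lookup_add)
      then have "l = 0" by (intro poly_mapping_eqI) simp
      with k show "m \<in> invariant_exponents d a" by simp
    qed
    have degree: "(\<Sum>v\<in>UNIV. Poly_Mapping.lookup (Poly_Mapping.map_key \<pi> m) v)
        = (\<Sum>v\<in>UNIV. Poly_Mapping.lookup m v)" for m :: "var \<Rightarrow>\<^sub>0 nat"
      using sum.reindex_bij_betw[OF assms(3), of "Poly_Mapping.lookup m"]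
      by (simp add: lookup_map_key bij_is_inj[OF assms(3)])
    show ?R if "\<forall>m. Poly_Mapping.map_key \<pi> m \<in> U a \<longleftrightarrow> m \<in> U b"
      using that by (auto simp: exps degree)
    show "\<forall>m. Poly_Mapping.map_key \<pi> m \<in> U a \<longleftrightarrow> m \<in> U b" if R: ?R
    proof
      fix m
      have add: "Poly_Mapping.map_key \<pi> (l + k) = Poly_Mapping.map_key \<pi> l + Poly_Mapping.map_key \<pi> k"
        for l k :: "var \<Rightarrow>\<^sub>0 nat"
        by (rule map_key_plus) (rule bij_is_inj[OF assms(3)])
      show "Poly_Mapping.map_key \<pi> m \<in> U a \<longleftrightarrow> m \<in> U b"
      proof
        assume "Poly_Mapping.map_key \<pi> m \<in> U a"
        then obtain k l where k: "k \<in> invariant_exponents d a" "Poly_Mapping.map_key \<pi> m = l + k"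
          by (auto simp: U_def)
        have "l + k = Poly_Mapping.map_key \<pi>
            (Poly_Mapping.map_key (inv \<pi>) l + Poly_Mapping.map_key (inv \<pi>) k)"
          by (simp add: add map_key_bij_inverse[OF assms(3)])
        then have "m = Poly_Mapping.map_key (inv \<pi>) l + Poly_Mapping.map_key (inv \<pi>) k"
          using k(2) map_key_bij_inverse(2)[OF assms(3)] by metis
        moreover have "Poly_Mapping.map_key (inv \<pi>) k \<in> invariant_exponents d b"
          using R[rule_format, of "Poly_Mapping.map_key (inv \<pi>) k"] k(1)
          by (simp add: map_key_bij_inverse[OF assms(3)])
        ultimately show "m \<in> U b" unfolding U_def by blast
      next
        assume "m \<in> U b"
        then obtain k l where "k \<in> invariant_exponents d b" "m = l + k" by (auto simp: U_def)
        then show "Poly_Mapping.map_key \<pi> m \<in> U a" unfolding U_def using R add by blast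
      qed
    qed
  qed
  finally show ?thesis .
qed

section \<open>Equivalence of actions as a relation between exponent sets\<close>

lemma equivalent_actions_iff:
  fixes e :: "'k::idom"
  assumes "primitive_root_of_1 d e" "d > 0"
  shows "(a, b) \<in> equivalent_actions e d \<longleftrightarrow> a \<in> {2..d - 1} \<and> b \<in> {2..d - 1} \<and>
    (\<exists>\<pi>. bij \<pi> \<and> (\<forall>m. Poly_Mapping.map_key \<pi> m \<in> invariant_exponents d a \<longleftrightarrow> m \<in> invariant_exponents d b))"
  unfolding equivalent_actions_def by (simp add: permute_vars_image_ideal_iff[OF assms] cong: conj_cong)

lemma equiv_equivalent_actions:
  fixes e :: "'k::idom"
  assumes "primitive_root_of_1 d e" "d > 0"
  shows "equiv {2..d - 1} (equivalent_actions e d)"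
proof (rule equivI)
  show "equivalent_actions e d \<subseteq> {2..d - 1} \<times> {2..d - 1}"
    by (auto simp: equivalent_actions_def)
  show "refl_on {2..d - 1} (equivalent_actions e d)"
  proof (rule refl_onI)
    fix a assume "a \<in> {2..d - 1}"
    moreover have "Poly_Mapping.map_key id m = m" for m :: "var \<Rightarrow>\<^sub>0 nat"
      by (intro poly_mapping_eqI) (simp add: lookup_map_key)
    ultimately show "(a, a) \<in> equivalent_actions e d"
      unfolding equivalent_actions_iff[OF assms] using bij_id by auto
  qed
  show "sym (equivalent_actions e d)"
  proof (rule symI)
    fix a b
    assume "(a, b) \<in> equivalent_actions e d"
    then obtain \<pi> where "bij \<pi>" and range: "a \<in> {2..d - 1}" "b \<in> {2..d - 1}"
      and \<pi>: "\<And>m. Poly_Mapping.map_key \<pi> m \<in> invariant_exponents d a \<longleftrightarrow> m \<in> invariant_exponents d b"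
      unfolding equivalent_actions_iff[OF assms] by blast
    have "Poly_Mapping.map_key (inv \<pi>) m \<in> invariant_exponents d b \<longleftrightarrow> m \<in> invariant_exponents d a" for m
      using \<pi>[of "Poly_Mapping.map_key (inv \<pi>) m"] by (simp add: map_key_bij_inverse[OF \<open>bij \<pi>\<close>])
    then show "(b, a) \<in> equivalent_actions e d"
      unfolding equivalent_actions_iff[OF assms] using range bij_imp_bij_inv[OF \<open>bij \<pi>\<close>] by blast
  qed
  show "trans (equivalent_actions e d)"
  proof (rule transI)
    fix a b c
    assume "(a, b) \<in> equivalent_actions e d" "(b, c) \<in> equivalent_actions e d"
    then obtain \<pi> \<sigma> where "bij \<pi>" "bij \<sigma>" and range: "a \<in> {2..d - 1}" "c \<in> {2..d - 1}"
      and \<pi>: "\<And>m. Poly_Mapping.map_key \<pi> m \<in> invariant_exponents d a \<longleftrightarrow> m \<in> invariant_exponents d b"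
      and \<sigma>: "\<And>m. Poly_Mapping.map_key \<sigma> m \<in> invariant_exponents d b \<longleftrightarrow> m \<in> invariant_exponents d c"
      unfolding equivalent_actions_iff[OF assms] by blast
    \<comment> \<open>Pullback is contravariant: \<sigma> acts first on m, then \<pi>, which yields
      the composite with \<pi> on the inside.\<close>
    have "Poly_Mapping.map_key (\<sigma> \<circ> \<pi>) m \<in> invariant_exponents d a \<longleftrightarrow> m \<in> invariant_exponents d c" for m
      using \<pi>[of "Poly_Mapping.map_key \<sigma> m"] \<sigma>[of m] \<open>bij \<pi>\<close> \<open>bij \<sigma>\<close>
      by (simp add: map_key_map_key bij_is_inj)
    moreover have "bij (\<sigma> \<circ> \<pi>)" using \<open>bij \<pi>\<close> \<open>bij \<sigma>\<close> by (rule bij_comp)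
    ultimately show "(a, c) \<in> equivalent_actions e d"
      unfolding equivalent_actions_iff[OF assms] using range by blast
  qed
qed

section \<open>Congruences between equivalent parameters\<close>

text \<open>The monomial \<open>x\<^bsup>b-1\<^esup> y\<^bsup>d-b\<^esup> z\<close> is invariant under \<open>M\<^sub>b\<close>; the six conditions are those for its
  six permutations to be invariant under \<open>M\<^sub>a\<close>.\<close>

lemma equivalent_actions_cong:
  fixes e :: "'k::idom"
  assumes "primitive_root_of_1 d e" "(a, b) \<in> equivalent_actions e d"
  defines "A \<equiv> int a" and "B \<equiv> int b" and "D \<equiv> int d"
  shows "[B = A] (mod D) \<or> [B = 1 - A] (mod D) \<or> [A * B = 1] (mod D) \<or>
    [A * (1 - B) = 1] (mod D) \<or> [(1 - A) * B = 1] (mod D) \<or> [(1 - A) * (1 - B) = 1] (mod D)"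
proof -
  have ab: "a \<in> {2..d - 1}" "b \<in> {2..d - 1}" using assms(2) by (auto simp: equivalent_actions_def)
  then have "d > 0" by auto
  obtain \<pi> where \<pi>: "bij \<pi>"
    "\<And>m. Poly_Mapping.map_key \<pi> m \<in> invariant_exponents d a \<longleftrightarrow> m \<in> invariant_exponents d b"
    using assms(2) equivalent_actions_iff[OF assms(1) \<open>d > 0\<close>] by blast
  \<comment> \<open>Its degree is (b - 1) + (d - b) + 1 = d, and its weight under M_b is (d - b) + b
    = d.\<close>
  define g where "g = Poly_Mapping.single X (b - 1) + Poly_Mapping.single Y (d - b) + Poly_Mapping.single Z 1"
  have g: "Poly_Mapping.lookup g X = b - 1" "Poly_Mapping.lookup g Y = d - b" "Poly_Mapping.lookup g Z = 1"
    by (simp_all add: g_def lookup_add lookup_single)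
  have "b < d" using ab by auto
  then have "g \<in> invariant_exponents d b"
    using ab by (simp add: invariant_exponents_def UNIV_var g)
  then have "d dvd Poly_Mapping.lookup g (\<pi> Y) + a * Poly_Mapping.lookup g (\<pi> Z)"
    using \<pi>(2)[of g] by (simp add: invariant_exponents_def lookup_map_key bij_is_inj[OF \<pi>(1)])
  then have "D dvd int (Poly_Mapping.lookup g (\<pi> Y)) + A * int (Poly_Mapping.lookup g (\<pi> Z))"
    unfolding A_def D_def by (metis of_nat_add of_nat_dvd_iff of_nat_mult)
  then obtain k
    where k: "int (Poly_Mapping.lookup g (\<pi> Y)) + A * int (Poly_Mapping.lookup g (\<pi> Z)) = D * k"
    by (elim dvdE)
  have g': "int (Poly_Mapping.lookup g X) = B - 1" "int (Poly_Mapping.lookup g Y) = D - B"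
    "int (Poly_Mapping.lookup g Z) = 1"
    using ab \<open>b < d\<close> by (auto simp: g B_def D_def of_nat_diff)
  \<comment> \<open>The variable x has weight 0, so only the images of y and z matter: six ordered
    pairs of distinct variables, one for each congruence.\<close>
  have "\<pi> Y \<noteq> \<pi> Z" using \<pi>(1) by (metis bij_pointE var.distinct(5))
  then consider "\<pi> Y = X" "\<pi> Z = Y" | "\<pi> Y = X" "\<pi> Z = Z" | "\<pi> Y = Y" "\<pi> Z = X"
    | "\<pi> Y = Y" "\<pi> Z = Z" | "\<pi> Y = Z" "\<pi> Z = X" | "\<pi> Y = Z" "\<pi> Z = Y"
    by (metis var.exhaust)
  then show ?thesis
  proof cases
    case 1
    \<comment> \<open>The exponent D - B stands for -B modulo D; the surplus multiple of D goes into
      the cofactor, here and in the other cases with this exponent.\<close>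
    then have "(1 - A) * B - 1 = D * (k - A)" using k by (simp add: g' algebra_simps)
    then show ?thesis by (auto simp: cong_iff_dvd_diff)
  next
    case 2
    then have "B - (1 - A) = D * k" using k by (simp add: g' algebra_simps)
    then show ?thesis by (auto simp: cong_iff_dvd_diff)
  next
    case 3
    then have "(1 - A) * (1 - B) - 1 = D * (k - 1)" using k by (simp add: g' algebra_simps)
    then show ?thesis by (auto simp: cong_iff_dvd_diff)
  next
    case 4
    then have "B - A = D * (1 - k)" using k by (simp add: g' algebra_simps)
    then show ?thesis by (auto simp: cong_iff_dvd_diff)
  next
    case 5
    then have "A * (1 - B) - 1 = D * (- k)" using k by (simp add: g' algebra_simps)
    then have "D dvd A * (1 - B) - 1" by (metis dvd_triv_left)
    then show ?thesis by (auto simp: cong_iff_dvd_diff)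
  next
    case 6
    then have "A * B - 1 = D * (A - k)" using k by (simp add: g' algebra_simps)
    then show ?thesis by (auto simp: cong_iff_dvd_diff)
  qed
qed

lemma cong_small_eq:
  assumes "[int b = int c] (mod int d)" "b \<in> {2..d - 1}" "c \<in> {2..d - 1}"
  shows "b = c"
proof -
  have "[b = c] (mod d)" using assms(1) by (simp add: cong_int_iff)
  then show ?thesis using assms by (intro cong_less_modulus_unique_nat) auto
qed

text \<open>The permutation exchanges x and y, and \<open>d + 1 - a\<close> represents 1 - a within
  the range. For i + j + k = d the weights i + a k and j + (d + 1 - a) k add up to d (1 + k), so d
  divides both or neither.\<close>

lemma equivalent_actions_reflect:
  fixes e :: "'k::idom"
  assumes "primitive_root_of_1 d e" "a \<in> {2..d - 1}"
  shows "(a, d + 1 - a) \<in> equivalent_actions e d"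
proof -
  define \<pi> where "\<pi> = (\<lambda>v. case v of X \<Rightarrow> Y | Y \<Rightarrow> X | Z \<Rightarrow> Z)"
  have "bij \<pi>" by (rule involuntory_imp_bij) (simp add: \<pi>_def split: var.splits)
  have "d dvd i + a * k \<longleftrightarrow> d dvd j + (d + 1 - a) * k" if "i + j + k = d" for i j k
  proof -
    have "(i + a * k) + (j + (d + 1 - a) * k) = (i + j) + (a + (d + 1 - a)) * k"
      by (simp add: distrib_right)
    also have "a + (d + 1 - a) = d + 1" using assms(2) by auto
    also have "(i + j) + (d + 1) * k = d * (1 + k)" using that by (simp add: algebra_simps)
    finally have "d dvd (i + a * k) + (j + (d + 1 - a) * k)" by simp
    then show ?thesis using dvd_add_right_iff dvd_add_left_iff by blast
  qed
  then have "Poly_Mapping.map_key \<pi> m \<in> invariant_exponents d a \<longleftrightarrow>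
      m \<in> invariant_exponents d (d + 1 - a)" for m
    by (auto simp: invariant_exponents_def UNIV_var lookup_map_key bij_is_inj[OF \<open>bij \<pi>\<close>] \<pi>_def)
  moreover have "d > 0" "d + 1 - a \<in> {2..d - 1}" using assms(2) by auto
  ultimately show ?thesis
    using assms \<open>bij \<pi>\<close> equivalent_actions_iff[OF assms(1)] by blast
qed

text \<open>The permutation exchanges y and z. Multiplying the weight j + b k by a gives a j + k
  modulo d. This later puts 2 into the class of 1/2.\<close>

lemma equivalent_actions_inverse:
  fixes e :: "'k::idom"
  assumes "primitive_root_of_1 d e" "a \<in> {2..d - 1}" "b \<in> {2..d - 1}" "[a * b = 1] (mod d)"
  shows "(a, b) \<in> equivalent_actions e d"
proof -
  define \<pi> where "\<pi> = (\<lambda>v. case v of X \<Rightarrow> X | Y \<Rightarrow> Z | Z \<Rightarrow> Y)"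
  have "bij \<pi>" by (rule involuntory_imp_bij) (simp add: \<pi>_def split: var.splits)
  \<comment> \<open>Stated for fresh a and b, so that it can also be applied with their roles
    exchanged.\<close>
  have swap: "d dvd k + a * j" if "d dvd j + b * k" "[a * b = 1] (mod d)" for a b j k
  proof -
    have "[a * (j + b * k) = a * j + 1 * k] (mod d)"
      using cong_add[OF cong_refl[of "a * j"] cong_mult[OF that(2) cong_refl[of k]]]
      by (simp add: algebra_simps)
    then show ?thesis using dvd_mult[OF that(1), of a] by (simp add: add.commute cong_dvd_iff)
  qed
  have "d dvd k + a * j \<longleftrightarrow> d dvd j + b * k" for j k
    using swap[of j b k a] swap[of k a j b] assms(4) by (auto simp: mult.commute)
  then have "Poly_Mapping.map_key \<pi> m \<in> invariant_exponents d a \<longleftrightarrow>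
      m \<in> invariant_exponents d b" for m
    by (auto simp: invariant_exponents_def UNIV_var lookup_map_key bij_is_inj[OF \<open>bij \<pi>\<close>] \<pi>_def)
  moreover have "d > 0" using assms(2) by auto
  ultimately show ?thesis
    using assms \<open>bij \<pi>\<close> equivalent_actions_iff[OF assms(1)] by blast
qed

section \<open>Counting the elements of a class\<close>

text \<open>Modulo n, b = b (a c) = c (a b) = c. If a is not a unit the premises fail, so units and
  nonunits are treated alike: an inverse condition has at most one solution.\<close>

lemma cong_inverse_unique:
  fixes a b c n :: int
  assumes "[a * b = 1] (mod n)" "[a * c = 1] (mod n)"
  shows "[b = c] (mod n)"
proof -
  have "[b * (a * c) = b * 1] (mod n)" "[c * (a * b) = c * 1] (mod n)"
    using cong_scalar_left[OF assms(2), of b] cong_scalar_left[OF assms(1), of c] by simp_all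
  then show ?thesis by (metis cong_sym cong_trans mult.left_commute mult.commute mult.right_neutral)
qed

lemma card_residue_condition_le_1:
  assumes "\<And>b c. P b \<Longrightarrow> P c \<Longrightarrow> [b = c] (mod int d)"
  shows "card {b \<in> {2..d - 1}. P (int b)} \<le> 1"
proof -
  have "b = c" if "b \<in> {2..d - 1}" "P (int b)" "c \<in> {2..d - 1}" "P (int c)" for b c
    using assms[OF that(2,4)] that(1,3) by (rule cong_small_eq)
  then show ?thesis by (auto simp: card_le_Suc0_iff_eq)
qed

text \<open>Remove an orbit {x, f x} and induct. The rest is stable, since f y in the orbit would
  force y into it. The contrapositive supplies a fixed point in a class of odd size.\<close>

lemma even_card_of_involution:
  assumes "finite S" "\<And>x. x \<in> S \<Longrightarrow> f x \<in> S \<and> f (f x) = x \<and> f x \<noteq> x"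
  shows "even (card S)"
  using assms
proof (induction "card S" arbitrary: S rule: less_induct)
  case less
  show ?case
  proof (cases "S = {}")
    case False
    then obtain x where x: "x \<in> S" by blast
    let ?T = "S - {x, f x}"
    have c: "card S = card ?T + 2"
    proof -
      have "card {x, f x} = 2" using less.prems(2)[OF x] by (auto simp: card_insert_if)
      moreover have "{x, f x} \<subseteq> S" using less.prems(2)[OF x] x by simp
      moreover from this have "card {x, f x} \<le> card S" by (rule card_mono[OF less.prems(1)])
      ultimately show ?thesis by (simp add: card_Diff_subset)
    qed
    moreover have "even (card ?T)"
    proof (rule less.hyps)
      fix y assume y: "y \<in> ?T"
      with less.prems(2)[OF x] less.prems(2)[of y] have "f y \<noteq> x" "f y \<noteq> f x" by auto
      with y less.prems(2)[of y] show "f y \<in> ?T \<and> f (f y) = y \<and> f y \<noteq> y" by simp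
    qed (use c less.prems(1) in auto)
    ultimately show ?thesis by simp
  qed simp
qed

lemma card_class:
  fixes e :: "'k::idom"
  assumes prim: "primitive_root_of_1 d e" and "d \<ge> 4" and C: "C \<in> action_classes e d"
  shows "card C \<in> {2, 3, 4, 6}"
proof -
  have "d > 0" using assms by simp
  let ?R = "equivalent_actions e d"
  let ?S = "\<lambda>P. {b \<in> {2..d - 1}. P (int b)}"
  note equiv = equiv_equivalent_actions[OF prim \<open>d > 0\<close>]
  have inA: "C \<subseteq> {2..d - 1}"
    using C equiv unfolding action_classes_def by (metis Union_quotient Union_upper)
  then have fin: "finite C" by (rule finite_subset) simp
  have nonempty: "C \<noteq> {}"
    using C equiv in_quotient_imp_non_empty unfolding action_classes_def by blast
  have C_eq: "C = ?R `` {a}" if "a \<in> C" for a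
    using that C equiv unfolding action_classes_def
    by (metis Image_singleton_iff equiv_class_eq quotientE)
  \<comment> \<open>Here a is an arbitrary integer, so both A and 1 - A can be put for it; likewise
    in the next two facts.\<close>
  have uniq_inv: "card (?S (\<lambda>b. [a * b = 1] (mod int d))) \<le> 1" for a
    by (rule card_residue_condition_le_1) (rule cong_inverse_unique)
  have uniq_inv': "card (?S (\<lambda>b. [a * (1 - b) = 1] (mod int d))) \<le> 1" for a
  proof (rule card_residue_condition_le_1)
    fix b c assume "[a * (1 - b) = 1] (mod int d)" "[a * (1 - c) = 1] (mod int d)"
    then have "[1 - b = 1 - c] (mod int d)" by (rule cong_inverse_unique)
    from cong_diff[OF cong_refl[of 1] this] show "[b = c] (mod int d)" by simp
  qed
  have uniq: "card (?S (\<lambda>b. [b = a] (mod int d))) \<le> 1" for a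
    by (rule card_residue_condition_le_1) (meson cong_sym cong_trans)
  have le6: "card C \<le> 6"
  proof -
    obtain a where "a \<in> C" using nonempty by blast
    define A where "A = int a"
    let ?U = "?S (\<lambda>b. [b = A] (mod int d)) \<union> (?S (\<lambda>b. [b = 1 - A] (mod int d)) \<union>
      (?S (\<lambda>b. [A * b = 1] (mod int d)) \<union> (?S (\<lambda>b. [A * (1 - b) = 1] (mod int d)) \<union>
      (?S (\<lambda>b. [(1 - A) * b = 1] (mod int d)) \<union> ?S (\<lambda>b. [(1 - A) * (1 - b) = 1] (mod int d))))))"
    have "C \<subseteq> ?U"
    proof
      fix b assume b: "b \<in> C"
      then have "(a, b) \<in> ?R" using C_eq[OF \<open>a \<in> C\<close>] by blast
      from equivalent_actions_cong[OF prim this] b inA show "b \<in> ?U" unfolding A_def by blast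
    qed
    then have "card C \<le> card ?U" by (rule card_mono[rotated]) simp
    also have "\<dots> \<le> 1 + (1 + (1 + (1 + (1 + 1))))"
      by (intro order_trans[OF card_Un_le] add_mono uniq uniq_inv uniq_inv')
    finally show ?thesis by simp
  qed
  show ?thesis
  proof (cases "even (card C)")
    case True
    have "card C \<noteq> 0" using fin nonempty by simp
    \<comment> \<open>The even numbers from 1 to 6 are 2, 4 and 6.\<close>
    with True le6 show ?thesis by (auto elim!: evenE)
  next
    case False
    have "(d + 1 - a) \<in> C \<and> d + 1 - (d + 1 - a) = a" if "a \<in> C" for a
      using that inA C_eq[OF that] equivalent_actions_reflect[OF prim, of a] by fastforce
    then obtain c where c: "c \<in> C" "d + 1 - c = c"
      using even_card_of_involution[OF fin, of "\<lambda>a. d + 1 - a"] False by blast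
    \<comment> \<open>The subtraction is not truncated because c < d. Hence d is odd and c is 1/2
      modulo d.\<close>
    then have dc: "d + 1 = 2 * c" using inA by auto
    have half: "[1 - int c = int c] (mod int d)"
      using dc by (auto simp: cong_iff_dvd_diff intro!: dvdI[of _ _ "-1"])
    \<comment> \<open>As 1 - c and c agree modulo d, the six conditions coincide in pairs. The three
      that remain say that b is 1/2, 2 or -1.\<close>
    let ?U = "?S (\<lambda>b. [b = int c] (mod int d)) \<union>
      (?S (\<lambda>b. [int c * b = 1] (mod int d)) \<union> ?S (\<lambda>b. [int c * (1 - b) = 1] (mod int d)))"
    have "C \<subseteq> ?U"
    proof
      fix b assume b: "b \<in> C"
      then have R: "(c, b) \<in> ?R" using C_eq[OF \<open>c \<in> C\<close>] by blast
      have "[(1 - int c) * x = int c * x] (mod int d)" for x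
        using half by (rule cong_scalar_right)
      then show "b \<in> ?U" using equivalent_actions_cong[OF prim R] b inA half 
        by (smt (verit) UnI1 UnI2 cong_sym cong_trans mem_Collect_eq subsetD)
    qed
    then have "card C \<le> card ?U" by (rule card_mono[rotated]) simp
    also have "\<dots> \<le> 1 + (1 + 1)"
      by (intro order_trans[OF card_Un_le] add_mono uniq uniq_inv uniq_inv')
    finally have "card C \<le> 3" by simp
    moreover have "card C \<noteq> 1"
    proof
      assume "card C = 1"
      \<comment> \<open>From 2 c = d + 1, the residue 2 is inverse to c and lies in the same class.
        A singleton class would then give c = 2 and d = 3; for d = 3 the class {2} is indeed a
        singleton.\<close>
      have "(c, 2) \<in> ?R"
      proof (rule equivalent_actions_inverse[OF prim])
        show "[c * 2 = 1] (mod d)" using dc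
          by (metis cong_add_lcancel_0_nat cong_def mod_add_self1 mult.commute)
      qed (use c inA \<open>d \<ge> 4\<close> in auto)
      then have "2 \<in> C" using C_eq[OF c(1)] by blast
      then have "c = 2" using c \<open>card C = 1\<close> by (metis card_1_singletonE singletonD)
      then show False using dc \<open>d \<ge> 4\<close> by simp
    qed
    moreover have "card C \<noteq> 0" "card C \<noteq> 2" using False by (metis even_zero, metis dvd_refl)
    ultimately show ?thesis by auto
  qed
qed

theorem theorem6p7:
  fixes e :: "'k::{alg_closed_field, field_char_0}"
    and d r :: nat and p \<alpha> :: "nat \<Rightarrow> nat"
  assumes "d \<ge> 3"
    and "d \<noteq> 3"
    and "primitive_root_of_1 d e"
    and "d = (\<Prod>i\<le>r. p i ^ \<alpha> i)"
    and "\<forall>i\<le>r. prime (p i)"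
    and "inj_on p {..r}"
    and "p 0 = 2"
    and "r \<ge> 1 \<longrightarrow> p 1 = 3"
    and "\<forall>i. 2 \<le> i \<and> i \<le> r \<longrightarrow> p i > 3"
    and "\<forall>i. 2 \<le> i \<and> i \<le> r \<longrightarrow> \<alpha> i > 0"
  shows "card (action_classes e d) =
    N_classes e d 2 + N_classes e d 3 + N_classes e d 4 + N_classes e d 6"
proof -
  have "finite (action_classes e d)"
    unfolding action_classes_def by (rule finite_quotient) (auto simp: equivalent_actions_def)
  \<comment> \<open>The classes are sorted by size: different sizes give disjoint families, and
    \<open>card_class\<close> shows that these four sizes exhaust all classes.\<close>
  then have "card (action_classes e d) =
      (\<Sum>i\<in>{2, 3, 4, 6}. card {C \<in> action_classes e d. card C = i})"
    using assms card_class[OF assms(3)]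
    by (subst card_UN_disjoint[symmetric]) (auto intro!: arg_cong[where f = card])
  then show ?thesis by (simp add: N_classes_def)
qed

end
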